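(* Let $M$ be a Poisson manifold and let $*$ be a Hermitian star product on $M$. Then the $^*$-algebra $(C^\infty_0(M)[[\lambda]],* )$ over $\mathbb{C}[[\lambda]]$, with complex conjugation as $^*$-involution, has sufficiently many positive $\mathbb{C}[[\lambda]]$-linear functionals. That is, for every $0\neq f\in C^\infty_0(M)[[\lambda]]$ with $\overline{f}=f$ there exists a $\mathbb{C}[[\lambda]]$-linear functional $\omega: C^\infty_0(M)[[\lambda]]\to\mathbb{C}[[\lambda]]$ such that $\omega(\overline{g}*g)\ge 0$ for all $g\in C^\infty_0(M)[[\lambda]]$ and $\omega(f)\neq 0$.
   Context: $C^\infty_0(M)$ denotes the complex-valued smooth functions with compact support on $M$. The ring $\mathbb{R}[[\lambda]]$ is ordered by declaring $a=\sum_{r=r_0}^\infty\lambda^r a_r$ with $a_{r_0}\neq 0$ to be positive iff $a_{r_0}>0$; $\mathbb{C}[[\lambda]]=\mathbb{R}[[\lambda]](\mathrm{i})$; complex conjugation is extended to formal power series coefficientwise (so $\overline{\lambda}=\lambda$). A statement $z\ge 0$ for $z\in\mathbb{C}[[\lambda]]$ means that $z\in\mathbb{R}[[\lambda]]$ and $z$ is zero or positive. A star product on a Poisson manifold $(M,\{\cdot,\cdot\})$ is an associative $\mathbb{C}[[\lambda]]$-bilinear product on $C^\infty(M)[[\lambda]]$ of the form $f*g=\sum_{r=0}^\infty\lambda^r\mu_r(f\otimes g)$ for $f,g\in C^\infty(M)$, where each $\mu_r$ is a bidifferential operator, $\mu_0(f\otimes g)=fg$ is the pointwise product, and $f*g-g*f=\mathrm{i}\lambda\{f,g\}+O(\lambda^2)$.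 It restricts to $C^\infty_0(M)[[\lambda]]$. It is called Hermitian if $\overline{f*g}=\overline{g}*\overline{f}$ for all $f,g$. *)

theory Defs
  imports
    "HOL-Analysis.Analysis"
    "HOL-Computational_Algebra.Formal_Power_Series"
    "HOL-Library.Function_Algebras"
begin

section \<open>Calculus on open subsets of \<open>\<real>\<^sup>n\<close>\<close>

text \<open>
  The model space is \<^term>\<open>Euclidean_space n\<close>, the real sequences vanishing from index \<open>n\<close> on.
  Here \<open>n\<close> is an arbitrary natural number, 0 included.
\<close>

definition partial_deriv ::
    "nat \<Rightarrow> ((nat \<Rightarrow> real) \<Rightarrow> 'b::real_normed_vector) \<Rightarrow> (nat \<Rightarrow> real) \<Rightarrow> 'b" where
  "partial_deriv i f = (\<lambda>x. vector_derivative (\<lambda>t. f (x(i := t))) (at (x i)))"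

definition partial_derivs ::
    "nat list \<Rightarrow> ((nat \<Rightarrow> real) \<Rightarrow> 'b::real_normed_vector) \<Rightarrow> (nat \<Rightarrow> real) \<Rightarrow> 'b" where
  "partial_derivs is f = foldr partial_deriv is f"

text \<open>
  For \<open>V\<close> open in \<^term>\<open>Euclidean_space n\<close>: all iterated partial derivatives exist and are
  continuous on \<open>V\<close>.  The values of \<open>f\<close> outside \<open>V\<close> play no role.
\<close>

definition smooth_on ::
    "nat \<Rightarrow> (nat \<Rightarrow> real) set \<Rightarrow> ((nat \<Rightarrow> real) \<Rightarrow> 'b::real_normed_vector) \<Rightarrow> bool" where
  "smooth_on n V f \<longleftrightarrow>
    (\<forall>is. set is \<subseteq> {..<n} \<longrightarrow>
      continuous_map (subtopology (Euclidean_space n) V) euclidean (partial_derivs is f) \<and>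
      (\<forall>x\<in>V. \<forall>i<n. (\<lambda>t. partial_derivs is f (x(i := t))) differentiable (at (x i))))"


section \<open>Smooth manifolds\<close>

text \<open>
  A chart is a pair \<open>(U, \<phi>)\<close> of its domain and its coordinate map; only the values of \<open>\<phi>\<close> on \<open>U\<close>
  matter.
\<close>

type_synonym 'a chart = "'a set \<times> ('a \<Rightarrow> nat \<Rightarrow> real)"

definition is_chart :: "nat \<Rightarrow> 'a topology \<Rightarrow> 'a chart \<Rightarrow> bool" where
  "is_chart n X = (\<lambda>(U, \<phi>).
    openin X U \<and> openin (Euclidean_space n) (\<phi> ` U) \<and>
    homeomorphic_map (subtopology X U) (subtopology (Euclidean_space n) (\<phi> ` U)) \<phi>)"

definition smoothly_compatible :: "nat \<Rightarrow> 'a chart \<Rightarrow> 'a chart \<Rightarrow> bool" where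
  "smoothly_compatible n = (\<lambda>(U, \<phi>) (V, \<psi>).
    \<forall>j<n. smooth_on n (\<phi> ` (U \<inter> V)) (\<lambda>x. \<psi> (inv_into U \<phi> x) j))"

text \<open>
  The smooth structure is given by an atlas \<open>A\<close>, not assumed maximal; the notions below depend
  only on the maximal atlas containing it.
\<close>

locale smooth_manifold =
  fixes n :: nat
    and X :: "'a topology"
    and A :: "'a chart set"
  assumes Hausdorff: "Hausdorff_space X"
    and second_countable: "second_countable X"
    and charts: "\<And>c. c \<in> A \<Longrightarrow> is_chart n X c"
    and cover: "(\<Union>(U, \<phi>)\<in>A. U) = topspace X"
    and compatible: "\<And>c d. c \<in> A \<Longrightarrow> d \<in> A \<Longrightarrow> smoothly_compatible n c d"

text \<open>
  Functions on the manifold are total functions on the ambient type that are 0 outside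
  \<^term>\<open>topspace X\<close>, so that equality of functions on the manifold is equality in HOL and the
  pointwise operations are those of the theory \<open>Function_Algebras\<close>.
\<close>

definition smooth_functions :: "nat \<Rightarrow> 'a topology \<Rightarrow> 'a chart set \<Rightarrow> ('a \<Rightarrow> complex) set" where
  "smooth_functions n X A =
    {f. (\<forall>(U, \<phi>)\<in>A. smooth_on n (\<phi> ` U) (f \<circ> inv_into U \<phi>)) \<and>
        (\<forall>x. x \<notin> topspace X \<longrightarrow> f x = 0)}"

definition test_functions :: "nat \<Rightarrow> 'a topology \<Rightarrow> 'a chart set \<Rightarrow> ('a \<Rightarrow> complex) set" where
  "test_functions n X A =
    {f \<in> smooth_functions n X A. compactin X (X closure_of {x \<in> topspace X. f x \<noteq> 0})}"

text \<open>
  In every chart, \<open>D f g = (\<Sum>I J. a\<^bsub>I J\<^esub> \<cdot> \<partial>\<^sub>I f \<cdot> \<partial>\<^sub>J g)\<close> with smooth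
  coefficients, where \<open>I\<close> and \<open>J\<close> run through the index lists \<open>[i\<^sub>1, \<dots>, i\<^sub>p]\<close> with
  \<open>p \<le> k\<close>.  The bound \<open>k\<close> on the order does not depend on the chart.
\<close>

definition bidifferential_operator ::
    "nat \<Rightarrow> 'a topology \<Rightarrow> 'a chart set \<Rightarrow>
      (('a \<Rightarrow> complex) \<Rightarrow> ('a \<Rightarrow> complex) \<Rightarrow> ('a \<Rightarrow> complex)) \<Rightarrow> bool" where
  "bidifferential_operator n X A D \<longleftrightarrow>
    (\<forall>f\<in>smooth_functions n X A. \<forall>g\<in>smooth_functions n X A. D f g \<in> smooth_functions n X A) \<and>
    (\<exists>k. \<forall>(U, \<phi>)\<in>A. \<exists>a.
      (\<forall>I J. smooth_on n (\<phi> ` U) (a I J)) \<and>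
      (\<forall>f\<in>smooth_functions n X A. \<forall>g\<in>smooth_functions n X A. \<forall>x\<in>U.
        D f g x =
          (\<Sum>I | set I \<subseteq> {..<n} \<and> length I \<le> k. \<Sum>J | set J \<subseteq> {..<n} \<and> length J \<le> k.
            a I J (\<phi> x) * partial_derivs I (f \<circ> inv_into U \<phi>) (\<phi> x)
                        * partial_derivs J (g \<circ> inv_into U \<phi>) (\<phi> x))))"


section \<open>Poisson manifolds\<close>

text \<open>
  The bracket is the complex bilinear extension of the Poisson bracket of real functions to the
  complex-valued smooth functions; \<open>br_real\<close> says that it restricts to the real ones.
\<close>

locale poisson_manifold = smooth_manifold n X A
  for n :: nat and X :: "'a topology" and A :: "'a chart set" +
  fixes br :: "('a \<Rightarrow> complex) \<Rightarrow> ('a \<Rightarrow> complex) \<Rightarrow> ('a \<Rightarrow> complex)"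
  assumes br_closed: "\<lbrakk>f \<in> smooth_functions n X A; g \<in> smooth_functions n X A\<rbrakk>
      \<Longrightarrow> br f g \<in> smooth_functions n X A"
    and br_add: "\<lbrakk>f \<in> smooth_functions n X A; g \<in> smooth_functions n X A; h \<in> smooth_functions n X A\<rbrakk>
      \<Longrightarrow> br (f + g) h = br f h + br g h"
    and br_scale: "\<lbrakk>f \<in> smooth_functions n X A; g \<in> smooth_functions n X A\<rbrakk>
      \<Longrightarrow> br (\<lambda>x. c * f x) g = (\<lambda>x. c * br f g x)"
    and br_antisym: "\<lbrakk>f \<in> smooth_functions n X A; g \<in> smooth_functions n X A\<rbrakk>
      \<Longrightarrow> br f g = - br g f"
    and br_Leibniz: "\<lbrakk>f \<in> smooth_functions n X A; g \<in> smooth_functions n X A; h \<in> smooth_functions n X A\<rbrakk>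
      \<Longrightarrow> br f (g * h) = br f g * h + g * br f h"
    and br_Jacobi: "\<lbrakk>f \<in> smooth_functions n X A; g \<in> smooth_functions n X A; h \<in> smooth_functions n X A\<rbrakk>
      \<Longrightarrow> br f (br g h) + br g (br h f) + br h (br f g) = 0"
    and br_real: "\<lbrakk>f \<in> smooth_functions n X A; g \<in> smooth_functions n X A\<rbrakk>
      \<Longrightarrow> br (\<lambda>x. cnj (f x)) (\<lambda>x. cnj (g x)) = (\<lambda>x. cnj (br f g x))"


section \<open>Formal power series in \<open>\<lambda>\<close>\<close>

text \<open>The set \<open>S[[\<lambda>]]\<close>.\<close>

definition formal_series :: "('a \<Rightarrow> complex) set \<Rightarrow> ('a \<Rightarrow> complex) fps set" where
  "formal_series S = {F. \<forall>r. fps_nth F r \<in> S}"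

text \<open>The module structure over \<open>\<complex>[[\<lambda>]]\<close>.\<close>

definition series_scale :: "complex fps \<Rightarrow> ('a \<Rightarrow> complex) fps \<Rightarrow> ('a \<Rightarrow> complex) fps" where
  "series_scale c F = Abs_fps (\<lambda>r x. \<Sum>s\<le>r. fps_nth c s * fps_nth F (r - s) x)"

definition series_cnj :: "('a \<Rightarrow> complex) fps \<Rightarrow> ('a \<Rightarrow> complex) fps" where
  "series_cnj F = Abs_fps (\<lambda>r x. cnj (fps_nth F r x))"

definition fps_positive :: "real fps \<Rightarrow> bool" where
  "fps_positive a \<longleftrightarrow> a \<noteq> 0 \<and> fps_nth a (subdegree a) > 0"

definition fps_complex_nonneg :: "complex fps \<Rightarrow> bool" where
  "fps_complex_nonneg z \<longleftrightarrow>
    (\<exists>a. z = Abs_fps (\<lambda>r. complex_of_real (fps_nth a r)) \<and> (a = 0 \<or> fps_positive a))"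


section \<open>Star products\<close>

text \<open>
  The formula \<open>f * g = (\<Sum>r. \<lambda>\<^sup>r \<mu>\<^sub>r(f, g))\<close> is required for \<open>f\<close> and \<open>g\<close> without higher
  orders in \<open>\<lambda>\<close>; bilinearity over \<open>\<complex>[[\<lambda>]]\<close> determines the product of arbitrary series from it.
  No condition is imposed on \<open>star\<close> outside the formal series of smooth functions.
\<close>

locale star_product = poisson_manifold n X A br
  for n :: nat and X :: "'a topology" and A :: "'a chart set"
    and br :: "('a \<Rightarrow> complex) \<Rightarrow> ('a \<Rightarrow> complex) \<Rightarrow> ('a \<Rightarrow> complex)" +
  fixes star :: "('a \<Rightarrow> complex) fps \<Rightarrow> ('a \<Rightarrow> complex) fps \<Rightarrow> ('a \<Rightarrow> complex) fps"
  assumes star_closed: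
      "\<lbrakk>F \<in> formal_series (smooth_functions n X A); G \<in> formal_series (smooth_functions n X A)\<rbrakk>
      \<Longrightarrow> star F G \<in> formal_series (smooth_functions n X A)"
    and star_add_left:
      "\<lbrakk>F \<in> formal_series (smooth_functions n X A); G \<in> formal_series (smooth_functions n X A);
        H \<in> formal_series (smooth_functions n X A)\<rbrakk>
      \<Longrightarrow> star (F + G) H = star F H + star G H"
    and star_add_right:
      "\<lbrakk>F \<in> formal_series (smooth_functions n X A); G \<in> formal_series (smooth_functions n X A);
        H \<in> formal_series (smooth_functions n X A)\<rbrakk>
      \<Longrightarrow> star F (G + H) = star F G + star F H"
    and star_scale_left:
      "\<lbrakk>F \<in> formal_series (smooth_functions n X A); G \<in> formal_series (smooth_functions n X A)\<rbrakk>
      \<Longrightarrow> star (series_scale c F) G = series_scale c (star F G)"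
    and star_scale_right:
      "\<lbrakk>F \<in> formal_series (smooth_functions n X A); G \<in> formal_series (smooth_functions n X A)\<rbrakk>
      \<Longrightarrow> star F (series_scale c G) = series_scale c (star F G)"
    and star_assoc:
      "\<lbrakk>F \<in> formal_series (smooth_functions n X A); G \<in> formal_series (smooth_functions n X A);
        H \<in> formal_series (smooth_functions n X A)\<rbrakk>
      \<Longrightarrow> star (star F G) H = star F (star G H)"
    and star_expansion:
      "\<exists>\<mu>. (\<forall>r. bidifferential_operator n X A (\<mu> r)) \<and>
        (\<forall>f\<in>smooth_functions n X A. \<forall>g\<in>smooth_functions n X A.
          \<mu> 0 f g = f * g \<and>
          star (fps_const f) (fps_const g) = Abs_fps (\<lambda>r. \<mu> r f g))"
    and star_commutator:
      "\<lbrakk>f \<in> smooth_functions n X A; g \<in> smooth_functions n X A\<rbrakk>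
      \<Longrightarrow> \<exists>R \<in> formal_series (smooth_functions n X A).
        star (fps_const f) (fps_const g) - star (fps_const g) (fps_const f)
          = series_scale fps_X (fps_const (\<lambda>x. \<i> * br f g x)) + series_scale (fps_X ^ 2) R"

locale hermitian_star_product = star_product n X A br star
  for n :: nat and X :: "'a topology" and A :: "'a chart set"
    and br :: "('a \<Rightarrow> complex) \<Rightarrow> ('a \<Rightarrow> complex) \<Rightarrow> ('a \<Rightarrow> complex)"
    and star :: "('a \<Rightarrow> complex) fps \<Rightarrow> ('a \<Rightarrow> complex) fps \<Rightarrow> ('a \<Rightarrow> complex) fps" +
  assumes star_hermitian:
      "\<lbrakk>F \<in> formal_series (smooth_functions n X A); G \<in> formal_series (smooth_functions n X A)\<rbrakk>
      \<Longrightarrow> series_cnj (star F G) = star (series_cnj G) (series_cnj F)"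


section \<open>Positive functionals\<close>

text \<open>
  Below, \<open>\<A>\<close> is the carrier of a \<open>*\<close>-algebra over \<open>\<complex>[[\<lambda>]]\<close> with product \<open>star\<close> and
  involution \<^const>\<open>series_cnj\<close>.  A functional on \<open>\<A>\<close> is a total function of which only the values
  on \<open>\<A>\<close> matter.
\<close>

definition series_linear_functional ::
    "('a \<Rightarrow> complex) fps set \<Rightarrow> (('a \<Rightarrow> complex) fps \<Rightarrow> complex fps) \<Rightarrow> bool" where
  "series_linear_functional \<A> \<omega> \<longleftrightarrow>
    (\<forall>F\<in>\<A>. \<forall>G\<in>\<A>. \<omega> (F + G) = \<omega> F + \<omega> G) \<and>
    (\<forall>c. \<forall>F\<in>\<A>. \<omega> (series_scale c F) = c * \<omega> F)"

definition positive_functional ::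
    "('a \<Rightarrow> complex) fps set \<Rightarrow>
      (('a \<Rightarrow> complex) fps \<Rightarrow> ('a \<Rightarrow> complex) fps \<Rightarrow> ('a \<Rightarrow> complex) fps) \<Rightarrow>
      (('a \<Rightarrow> complex) fps \<Rightarrow> complex fps) \<Rightarrow> bool" where
  "positive_functional \<A> star \<omega> \<longleftrightarrow>
    series_linear_functional \<A> \<omega> \<and> (\<forall>G\<in>\<A>. fps_complex_nonneg (\<omega> (star (series_cnj G) G)))"

definition sufficiently_many_positive_functionals ::
    "('a \<Rightarrow> complex) fps set \<Rightarrow>
      (('a \<Rightarrow> complex) fps \<Rightarrow> ('a \<Rightarrow> complex) fps \<Rightarrow> ('a \<Rightarrow> complex) fps) \<Rightarrow> bool" where
  "sufficiently_many_positive_functionals \<A> star \<longleftrightarrow>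
    (\<forall>F\<in>\<A>. F \<noteq> 0 \<and> series_cnj F = F \<longrightarrow>
      (\<exists>\<omega>. positive_functional \<A> star \<omega> \<and> \<omega> F \<noteq> 0))"

end

theory Submission
  imports Defs
begin

text \<open>
  A positive functional that vanishes on no \<open>\<bar>g\<bar>\<^sup>2\<close> with \<open>g \<noteq> 0\<close> needs no quantum corrections.
  Let \<open>\<phi>\<close> be a functional on the complex functions that is linear on the bounded ones, commutes
  with conjugation and satisfies \<open>\<phi>(\<bar>g\<bar>\<^sup>2) > 0\<close> for every test function \<open>g \<noteq> 0\<close>, and apply \<open>\<phi>\<close> to a formal series
  coefficient by coefficient.  If \<open>\<lambda>\<^sup>k g\<^sub>k\<close> is the lowest term of \<open>G \<noteq> 0\<close>, then the product of
  \<open>G\<close> with its conjugate has the lowest term \<open>\<lambda>\<^sup>2\<^sup>k \<bar>g\<^sub>k\<bar>\<^sup>2\<close>, since \<open>\<mu>\<^sub>0\<close> is the pointwise product.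
  The value of the functional on it has the leading coefficient \<open>\<phi>(\<bar>g\<^sub>k\<bar>\<^sup>2) > 0\<close>, and its other
  coefficients are real because the star product is Hermitian.  In the ordering of \<open>\<real>[[\<lambda>]]\<close> only
  the leading coefficient counts, so the value is positive (lemma \<open>coeffwise_star_square_nonneg\<close>).

  Such functionals \<open>\<phi>\<close> abound.  As \<open>X\<close> is second countable, it has a dense sequence
  \<open>d\<^sub>0, d\<^sub>1, \<dots>\<close>, and \<open>\<phi>(f) = c f(p) + (\<Sum>i. 2\<^sup>-\<^sup>i f(d\<^sub>i))\<close> with \<open>c \<ge> 0\<close> will do.  If
  \<open>f\<close> is the leading coefficient of a nonzero series and \<open>f(p) \<noteq> 0\<close>, then \<open>\<phi>(f) \<noteq> 0\<close> for \<open>c = 0\<close>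
  or for \<open>c = 1\<close>.
\<close>


section \<open>Conjugation and continuity of smooth functions\<close>

lemma continuous_map_fun_upd_Euclidean_space:
  assumes "x \<in> topspace (Euclidean_space n)" "i < n"
  shows "continuous_map euclideanreal (Euclidean_space n) (\<lambda>t. x(i := t))"
proof -
  have "continuous_map euclideanreal euclideanreal (\<lambda>t. if j = i then t else x j)" for j
    by (cases "j = i") auto
  then have "continuous_map euclideanreal (powertop_real UNIV) (\<lambda>t. x(i := t))"
    by (simp add: continuous_map_componentwise_UNIV fun_upd_def)
  then show ?thesis
    using assms unfolding Euclidean_space_def
    by (auto simp: continuous_map_in_subtopology)
qed

lemma eventually_fun_upd_in_open:
  assumes "openin (Euclidean_space n) V" "x \<in> V" "i < n"
  shows "eventually (\<lambda>t. x(i := t) \<in> V) (nhds (x i))"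
proof -
  have "x \<in> topspace (Euclidean_space n)"
    using assms openin_subset by blast
  then have "openin euclideanreal {t \<in> topspace euclideanreal. x(i := t) \<in> V}"
    using continuous_map_fun_upd_Euclidean_space assms openin_continuous_map_preimage by blast
  then have "open {t. x(i := t) \<in> V}"
    by simp
  then show ?thesis
    using assms by (auto simp: eventually_nhds intro!: exI[of _ "{t. x(i := t) \<in> V}"])
qed

text \<open>
  Where a derivative does not exist, its value is arbitrary and need not commute with conjugation.
  The equality therefore holds only on \<open>V\<close>; it passes through each further derivative because \<open>V\<close>
  is open.
\<close>

lemma partial_derivs_cnj:
  assumes V: "openin (Euclidean_space n) V" and f: "smooth_on n V f"
  shows "set is \<subseteq> {..<n} \<Longrightarrow> x \<in> V \<Longrightarrow>
    partial_derivs is (\<lambda>y. cnj (f y)) x = cnj (partial_derivs is f x)"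
proof (induction "is" arbitrary: x)
  case Nil
  then show ?case by (simp add: partial_derivs_def)
next
  case (Cons i "is")
  let ?g = "partial_derivs is f" and ?h = "partial_derivs is (\<lambda>y. cnj (f y))"
  have i: "i < n" using Cons.prems by simp
  have diff: "(\<lambda>t. ?g (x(i := t))) differentiable (at (x i))"
    using f Cons.prems i unfolding smooth_on_def by auto
  have "eventually (\<lambda>t. ?h (x(i := t)) = cnj (?g (x(i := t)))) (nhds (x i))"
    using eventually_fun_upd_in_open[OF V Cons.prems(2) i]
    by eventually_elim (use Cons in auto)
  then have "vector_derivative (\<lambda>t. ?h (x(i := t))) (at (x i))
      = vector_derivative (\<lambda>t. cnj (?g (x(i := t)))) (at (x i))"
    by (intro vector_derivative_cong_eq) (auto elim: eventually_mono)
  also have "\<dots> = cnj (vector_derivative (\<lambda>t. ?g (x(i := t))) (at (x i)))"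
    by (rule vector_derivative_cnj[OF diff])
  finally show ?case
    by (simp add: partial_derivs_def partial_deriv_def)
qed

lemma smooth_on_cnj:
  assumes V: "openin (Euclidean_space n) V" and f: "smooth_on n V f"
  shows "smooth_on n V (\<lambda>x. cnj (f x))"
  unfolding smooth_on_def
proof (intro allI impI conjI ballI)
  fix "is" :: "nat list"
  assume s: "set is \<subseteq> {..<n}"
  let ?g = "partial_derivs is f" and ?h = "partial_derivs is (\<lambda>y. cnj (f y))"
  have "continuous_map (subtopology (Euclidean_space n) V) euclidean ?g"
    using f s unfolding smooth_on_def by auto
  moreover have "continuous_map euclidean euclidean cnj"
    by (simp add: continuous_on_cnj)
  ultimately have "continuous_map (subtopology (Euclidean_space n) V) euclidean (cnj \<circ> ?g)"
    by (rule continuous_map_compose)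
  then show "continuous_map (subtopology (Euclidean_space n) V) euclidean ?h"
    by (rule continuous_map_eq) (auto simp: partial_derivs_cnj[OF V f s])
  fix x i assume x: "x \<in> V" and i: "i < n"
  have "(\<lambda>t. ?g (x(i := t))) differentiable (at (x i))"
    using f s x i unfolding smooth_on_def by auto
  then obtain D where "((\<lambda>t. ?g (x(i := t))) has_vector_derivative D) (at (x i))"
    using vector_derivative_works by blast
  then have "((\<lambda>t. cnj (?g (x(i := t)))) has_vector_derivative cnj D) (at (x i))"
    by (rule has_vector_derivative_cnj)
  moreover have ev: "eventually (\<lambda>t. cnj (?g (x(i := t))) = ?h (x(i := t))) (nhds (x i))"
    using eventually_fun_upd_in_open[OF V x i]
    by eventually_elim (use partial_derivs_cnj[OF V f s] in auto)
  ultimately have "((\<lambda>t. ?h (x(i := t))) has_vector_derivative cnj D) (at (x i))"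
    by (subst has_vector_derivative_cong_ev[symmetric])
      (auto elim: eventually_mono dest: eventually_nhds_x_imp_x)
  then show "(\<lambda>t. ?h (x(i := t))) differentiable (at (x i))"
    by (rule differentiableI_vector)
qed

lemma partial_derivs_zero: "partial_derivs is (\<lambda>x. 0) = (\<lambda>x. 0)"
  by (induction "is") (auto simp: partial_derivs_def partial_deriv_def)

context smooth_manifold
begin

lemma smooth_functions_zero: "0 \<in> smooth_functions n X A"
  by (auto simp: smooth_functions_def smooth_on_def partial_derivs_zero o_def)

lemma smooth_functions_cnj:
  assumes "f \<in> smooth_functions n X A"
  shows "(\<lambda>x. cnj (f x)) \<in> smooth_functions n X A"
proof -
  have "smooth_on n (\<phi> ` U) ((\<lambda>x. cnj (f x)) \<circ> inv_into U \<phi>)" if "(U, \<phi>) \<in> A" for U \<phi>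
  proof -
    have "openin (Euclidean_space n) (\<phi> ` U)"
      using charts[OF that] by (simp add: is_chart_def)
    moreover have "smooth_on n (\<phi> ` U) (f \<circ> inv_into U \<phi>)"
      using assms that by (auto simp: smooth_functions_def)
    ultimately show ?thesis
      using smooth_on_cnj by (fastforce simp: o_def)
  qed
  then show ?thesis
    using assms by (auto simp: smooth_functions_def)
qed

lemma smooth_functions_continuous:
  assumes f: "f \<in> smooth_functions n X A"
  shows "continuous_map X euclidean f"
proof (rule pasting_lemma[where I = A and T = fst and f = "\<lambda>_. f"])
  fix c assume c: "c \<in> A"
  obtain U \<phi> where [simp]: "c = (U, \<phi>)" by (cases c)
  have ch: "openin X U"
    "homeomorphic_map (subtopology X U) (subtopology (Euclidean_space n) (\<phi> ` U)) \<phi>"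
    using charts[OF c] by (auto simp: is_chart_def)
  show "openin X (fst c)" using ch by simp
  have U: "topspace (subtopology X U) = U"
    using openin_subset[OF ch(1)] by auto
  have inj: "inj_on \<phi> U"
    using homeomorphic_imp_injective_map[OF ch(2)] by (simp only: U)
  have "continuous_map (subtopology (Euclidean_space n) (\<phi> ` U)) euclidean
      (partial_derivs [] (f \<circ> inv_into U \<phi>))"
    using f c unfolding smooth_functions_def smooth_on_def by fastforce
  then have "continuous_map (subtopology X U) euclidean ((f \<circ> inv_into U \<phi>) \<circ> \<phi>)"
    using continuous_map_compose[OF homeomorphic_imp_continuous_map[OF ch(2)]]
    by (simp add: partial_derivs_def)
  then have "continuous_map (subtopology X U) euclidean f"
    by (rule continuous_map_eq) (simp only: U, simp add: inj)
  then show "continuous_map (subtopology X (fst c)) euclidean f" by simp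
next
  fix x assume "x \<in> topspace X"
  then have "x \<in> (\<Union>(U, \<phi>)\<in>A. U)" by (simp only: cover)
  then show "\<exists>c. c \<in> A \<and> x \<in> fst c \<and> f x = f x"
    by (auto split: prod.splits)
qed auto

lemma test_functions_bounded:
  assumes f: "f \<in> test_functions n X A"
  shows "bounded (range f)"
proof -
  let ?K = "X closure_of {x \<in> topspace X. f x \<noteq> 0}"
  have sm: "f \<in> smooth_functions n X A" and K: "compactin X ?K"
    using f by (auto simp: test_functions_def)
  have "compactin euclidean (f ` ?K)"
    using image_compactin[OF K smooth_functions_continuous[OF sm]] .
  then have "bounded (insert 0 (f ` ?K))"
    by (simp add: compact_imp_bounded)
  moreover have "f x \<in> insert 0 (f ` ?K)" for x
  proof (cases "f x = 0")
    case False
    then have "x \<in> topspace X" using sm by (auto simp: smooth_functions_def)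
    then show ?thesis
      using False closure_of_subset[of "{x \<in> topspace X. f x \<noteq> 0}" X] by auto
  qed simp
  ultimately show ?thesis
    by (meson bounded_subset image_subsetI)
qed

end


section \<open>Faithful functionals from dense sequences\<close>

text \<open>
  The sum is the set-indexed one because it is 0 when it diverges: it then commutes with conjugation
  for all functions, bounded or not.
\<close>

definition atomic_functional :: "real \<Rightarrow> 'a \<Rightarrow> (nat \<Rightarrow> 'a) \<Rightarrow> ('a \<Rightarrow> complex) \<Rightarrow> complex" where
  "atomic_functional c p d f = of_real c * f p + (\<Sum>\<^sub>\<infinity>i. (1 / 2) ^ i * f (d i))"

lemma summable_on_geometric_bounded:
  fixes f :: "'a \<Rightarrow> complex"
  assumes "bounded (range f)"
  shows "(\<lambda>i::nat. (1 / 2) ^ i * f (d i)) summable_on UNIV"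
proof -
  obtain B where B: "\<And>x. norm (f x) \<le> B"
    using assms by (auto simp: bounded_iff)
  have "summable (\<lambda>i. (1 / 2 :: real) ^ i * B)"
    by (intro summable_mult2 summable_geometric) simp
  then have "summable (\<lambda>i. norm ((1 / 2) ^ i * f (d i)))"
    by (rule summable_comparison_test[rotated])
      (auto simp: norm_mult norm_power norm_divide intro!: exI[of _ 0] mult_left_mono B)
  then show ?thesis
    by (rule norm_summable_imp_summable_on)
qed

lemma atomic_functional_zero [simp]: "atomic_functional c p d (\<lambda>x. 0) = 0"
  by (simp add: atomic_functional_def)

lemma atomic_functional_cnj: "atomic_functional c p d (\<lambda>x. cnj (f x)) = cnj (atomic_functional c p d f)"
proof -
  have "(\<Sum>\<^sub>\<infinity>i. (1 / 2) ^ i * cnj (f (d i))) = (\<Sum>\<^sub>\<infinity>i. cnj ((1 / 2) ^ i * f (d i)))"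
    by simp
  then show ?thesis
    by (simp add: atomic_functional_def del: complex_cnj_mult)
      (simp add: infsum_cnj[symmetric])
qed

lemma atomic_functional_add:
  assumes "bounded (range f)" "bounded (range g)"
  shows "atomic_functional c p d (\<lambda>x. f x + g x) = atomic_functional c p d f + atomic_functional c p d g"
  using infsum_add[OF assms[THEN summable_on_geometric_bounded[where d = d]]]
  by (simp add: atomic_functional_def algebra_simps)

lemma atomic_functional_scale:
  "atomic_functional c p d (\<lambda>x. a * f x) = a * atomic_functional c p d f"
proof -
  have "(\<Sum>\<^sub>\<infinity>i. (1 / 2) ^ i * (a * f (d i))) = (\<Sum>\<^sub>\<infinity>i. a * ((1 / 2) ^ i * f (d i)))"
    by (simp add: mult.left_commute)
  also have "\<dots> = a * (\<Sum>\<^sub>\<infinity>i. (1 / 2) ^ i * f (d i))"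
    by (rule infsum_cmult_right')
  finally show ?thesis
    by (simp add: atomic_functional_def algebra_simps)
qed

lemma bounded_range_linear_combination:
  fixes f :: "'i \<Rightarrow> 'a \<Rightarrow> complex"
  assumes "finite I" "\<And>i. i \<in> I \<Longrightarrow> bounded (range (f i))"
  shows "bounded (range (\<lambda>x. \<Sum>i\<in>I. a i * f i x))"
  using assms
proof (induction I rule: finite_induct)
  case (insert i I)
  have "bounded (range (\<lambda>x. a i * f i x))"
    using insert.prems[of i] bounded_linear_image[OF _ bounded_linear_mult_right[of "a i"]]
    by (fastforce simp: image_image)
  then show ?case
    using insert by (simp add: bounded_plus_comp)
qed simp

lemma atomic_functional_linear_combination:
  assumes "finite I" "\<And>i. i \<in> I \<Longrightarrow> bounded (range (f i))"
  shows "atomic_functional c p d (\<lambda>x. \<Sum>i\<in>I. a i * f i x) = (\<Sum>i\<in>I. a i * atomic_functional c p d (f i))"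
  using assms
proof (induction I rule: finite_induct)
  case (insert i I)
  have "bounded (range (\<lambda>x. \<Sum>j\<in>{i}. a j * f j x))"
    "bounded (range (\<lambda>x. \<Sum>j\<in>I. a j * f j x))"
    using insert by (auto intro!: bounded_range_linear_combination simp del: sum.insert)
  then show ?case
    using insert by (simp add: atomic_functional_add atomic_functional_scale)
qed simp

lemma atomic_functional_square_pos:
  assumes "bounded (range g)" "c \<ge> 0" "g (d i) \<noteq> 0"
  shows "Re (atomic_functional c p d (\<lambda>x. cnj (g x) * g x)) > 0"
proof -
  let ?s = "\<lambda>j. (1 / 2) ^ j * (cnj (g (d j)) * g (d j))"
  have eq: "?s j = complex_of_real ((1 / 2) ^ j * (cmod (g (d j)))\<^sup>2)" for j
    by (simp add: complex_norm_square[symmetric] mult.commute)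
  obtain B where B: "\<And>x. norm (g x) \<le> B"
    using assms(1) by (auto simp: bounded_iff)
  have "bounded (range (\<lambda>x. cnj (g x) * g x))"
    unfolding bounded_iff
    by (rule exI[of _ "B * B"]) (auto simp: norm_mult intro!: mult_mono B order_trans[OF norm_ge_zero B])
  then have sum: "?s summable_on UNIV"
    by (rule summable_on_geometric_bounded)
  have nonneg: "0 \<le> ?s j" for j
    unfolding eq by (simp only: less_eq_complex_def) simp
  have "infsum ?s UNIV \<noteq> 0"
  proof
    assume "infsum ?s UNIV = 0"
    then have "?s i = 0"
      using nonneg_infsum_le_0D_complex[of ?s UNIV i] sum nonneg by simp
    then show False using assms(3) by simp
  qed
  moreover have "0 \<le> infsum ?s UNIV"
    by (rule infsum_nonneg_complex[OF sum nonneg])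
  ultimately have "Re (infsum ?s UNIV) > 0"
    by (auto simp: less_eq_complex_def complex_eq_iff)
  moreover have "Re (of_real c * (cnj (g p) * g p)) \<ge> 0"
    using assms(2) by simp
  ultimately show ?thesis
    by (simp add: atomic_functional_def)
qed

lemma (in smooth_manifold) exists_dense_sequence:
  assumes "topspace X \<noteq> {}"
  obtains d :: "nat \<Rightarrow> 'a" where
    "\<And>g. g \<in> smooth_functions n X A \<Longrightarrow> g \<noteq> 0 \<Longrightarrow> \<exists>i. g (d i) \<noteq> 0"
proof -
  obtain C where C: "countable C" "X closure_of C = topspace X"
    using second_countable_imp_separable_space[OF second_countable]
    by (auto simp: separable_space_def)
  have "C \<noteq> {}" using C(2) assms by (metis closure_of_empty)
  have "\<exists>i. g (from_nat_into C i) \<noteq> 0" if g: "g \<in> smooth_functions n X A" "g \<noteq> 0" for g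
  proof -
    let ?T = "{x \<in> topspace X. g x \<in> - {0}}"
    have "openin X ?T"
      by (rule openin_continuous_map_preimage[OF smooth_functions_continuous[OF g(1)]]) auto
    moreover have "?T \<noteq> {}"
      using g by (fastforce simp: smooth_functions_def fun_eq_iff)
    ultimately obtain x where "x \<in> C" "g x \<noteq> 0"
      using C(2) by (auto simp: dense_intersects_open)
    then show ?thesis
      using from_nat_into_surj[OF C(1)] by metis
  qed
  then show ?thesis by (rule that)
qed


section \<open>The lowest order of a star product\<close>

lemma series_scale_X_power:
  "series_scale (fps_X ^ k) F = Abs_fps (\<lambda>r. if r < k then 0 else fps_nth F (r - k))"
proof (rule fps_ext)
  fix r
  have "(\<Sum>s\<le>r. fps_nth (fps_X ^ k) s * fps_nth F (r - s) x)
      = (if r < k then 0 else fps_nth F (r - k) x)" for x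
  proof -
    have "(\<Sum>s\<le>r. fps_nth (fps_X ^ k) s * fps_nth F (r - s) x)
        = (\<Sum>s\<le>r. if s = k then fps_nth F (r - s) x else 0)"
      by (intro sum.cong) auto
    then show ?thesis by (auto simp: not_less)
  qed
  then show "fps_nth (series_scale (fps_X ^ k) F) r
      = fps_nth (Abs_fps (\<lambda>r. if r < k then 0 else fps_nth F (r - k))) r"
    by (auto simp: series_scale_def fun_eq_iff)
qed

lemma formal_series_shift:
  "F \<in> formal_series S \<Longrightarrow> fps_shift k F \<in> formal_series S"
  by (simp add: formal_series_def)

lemma series_scale_X_power_shift:
  assumes "\<And>r. r < k \<Longrightarrow> fps_nth F r = 0"
  shows "series_scale (fps_X ^ k) (fps_shift k F) = F"
  using assms by (intro fps_ext) (simp add: series_scale_X_power)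

lemma const_plus_X_shift:
  "fps_const (fps_nth F 0) + series_scale (fps_X ^ 1) (fps_shift 1 F) = F"
proof (rule fps_ext)
  fix r
  show "fps_nth (fps_const (fps_nth F 0) + series_scale (fps_X ^ 1) (fps_shift 1 F)) r = fps_nth F r"
    unfolding fps_add_nth series_scale_X_power by (cases r) simp_all
qed

context star_product
begin

lemma formal_series_const:
  "f \<in> smooth_functions n X A \<Longrightarrow> fps_const f \<in> formal_series (smooth_functions n X A)"
  using smooth_functions_zero by (simp add: formal_series_def)

lemma formal_series_X_power:
  assumes "F \<in> formal_series (smooth_functions n X A)"
  shows "series_scale (fps_X ^ k) F \<in> formal_series (smooth_functions n X A)"
  using assms smooth_functions_zero by (auto simp: formal_series_def series_scale_X_power)

text \<open>
  Write both factors as a constant plus \<open>\<lambda>\<close> times a series: bilinearity leaves only the product of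
  the constants in order 0, and there \<open>\<mu>\<^sub>0\<close> is the pointwise product.
\<close>

lemma star_nth_0:
  assumes F: "F \<in> formal_series (smooth_functions n X A)"
    and G: "G \<in> formal_series (smooth_functions n X A)"
  shows "fps_nth (star F G) 0 = fps_nth F 0 * fps_nth G 0"
proof -
  let ?\<S> = "formal_series (smooth_functions n X A)"
  define f F' where "f = fps_nth F 0" and "F' = fps_shift 1 F"
  define g G' where "g = fps_nth G 0" and "G' = fps_shift 1 G"
  have sm: "f \<in> smooth_functions n X A" "g \<in> smooth_functions n X A"
    using F G by (auto simp: f_def g_def formal_series_def)
  have mem: "F' \<in> ?\<S>" "G' \<in> ?\<S>" "fps_const f \<in> ?\<S>" "fps_const g \<in> ?\<S>"
    using F G sm by (auto simp: F'_def G'_def formal_series_shift formal_series_const)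
  note X = formal_series_X_power[of _ 1]
  have "star F G = star (fps_const f + series_scale (fps_X ^ 1) F') G"
    using const_plus_X_shift[of F] by (simp add: f_def F'_def)
  also have "\<dots> = star (fps_const f) G + series_scale (fps_X ^ 1) (star F' G)"
    using mem G X by (simp only: star_add_left star_scale_left)
  also have "star (fps_const f) G = star (fps_const f) (fps_const g + series_scale (fps_X ^ 1) G')"
    using const_plus_X_shift[of G] by (simp add: g_def G'_def)
  also have "\<dots> = star (fps_const f) (fps_const g) + series_scale (fps_X ^ 1) (star (fps_const f) G')"
    using mem X by (simp only: star_add_right star_scale_right)
  finally have "fps_nth (star F G) 0 = fps_nth (star (fps_const f) (fps_const g)) 0"
    by (simp only: fps_add_nth series_scale_X_power) simp
  also have "\<dots> = f * g"
  proof -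
    obtain \<mu> where "\<mu> 0 f g = f * g" "star (fps_const f) (fps_const g) = Abs_fps (\<lambda>r. \<mu> r f g)"
      using star_expansion sm by metis
    then show ?thesis by simp
  qed
  finally show ?thesis by (simp add: f_def g_def)
qed

lemma star_lowest_terms:
  assumes F: "F \<in> formal_series (smooth_functions n X A)"
    and G: "G \<in> formal_series (smooth_functions n X A)"
    and k: "\<And>r. r < k \<Longrightarrow> fps_nth F r = 0" and l: "\<And>r. r < l \<Longrightarrow> fps_nth G r = 0"
  shows "r < k + l \<Longrightarrow> fps_nth (star F G) r = 0"
    and "fps_nth (star F G) (k + l) = fps_nth F k * fps_nth G l"
proof -
  let ?F = "fps_shift k F" and ?G = "fps_shift l G"
  have mem: "?F \<in> formal_series (smooth_functions n X A)" "?G \<in> formal_series (smooth_functions n X A)"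
    using F G by (auto simp: formal_series_shift)
  have "star F G = star (series_scale (fps_X ^ k) ?F) (series_scale (fps_X ^ l) ?G)"
    using k l by (simp add: series_scale_X_power_shift)
  also have "\<dots> = series_scale (fps_X ^ l) (series_scale (fps_X ^ k) (star ?F ?G))"
    using mem formal_series_X_power by (simp only: star_scale_left star_scale_right)
  finally have eq: "star F G = \<dots>" .
  show "r < k + l \<Longrightarrow> fps_nth (star F G) r = 0"
    unfolding eq series_scale_X_power by auto
  show "fps_nth (star F G) (k + l) = fps_nth F k * fps_nth G l"
    unfolding eq series_scale_X_power using star_nth_0[OF mem] by simp
qed

end


section \<open>Positivity of the coefficientwise extension\<close>

definition coeffwise :: "(('a \<Rightarrow> complex) \<Rightarrow> complex) \<Rightarrow> ('a \<Rightarrow> complex) fps \<Rightarrow> complex fps" where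
  "coeffwise \<phi> F = Abs_fps (\<lambda>r. \<phi> (fps_nth F r))"

lemma coeffwise_atomic_linear:
  assumes "\<And>f. f \<in> S \<Longrightarrow> bounded (range f)"
  shows "series_linear_functional (formal_series S) (coeffwise (atomic_functional c p d))"
  unfolding series_linear_functional_def
proof (intro conjI ballI allI)
  let ?\<phi> = "atomic_functional c p d"
  fix F assume "F \<in> formal_series S"
  then have F: "bounded (range (fps_nth F r))" for r
    using assms by (auto simp: formal_series_def)
  { fix G assume "G \<in> formal_series S"
    then have G: "bounded (range (fps_nth G r))" for r
      using assms by (auto simp: formal_series_def)
    show "coeffwise ?\<phi> (F + G) = coeffwise ?\<phi> F + coeffwise ?\<phi> G"
      using atomic_functional_add[OF F G]
      by (intro fps_ext) (simp add: coeffwise_def plus_fun_def) }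
  fix a
  show "coeffwise ?\<phi> (series_scale a F) = a * coeffwise ?\<phi> F"
    using atomic_functional_linear_combination[OF _ F, where a = "fps_nth a"]
    by (intro fps_ext) (simp add: coeffwise_def series_scale_def fps_mult_nth atLeast0AtMost)
qed

text \<open>
  Only the leading coefficient of the value has to be computed; the Hermitian property makes all
  others real, and their signs do not matter.
\<close>

lemma (in hermitian_star_product) coeffwise_star_square_nonneg:
  assumes G: "G \<in> formal_series (smooth_functions n X A)"
    and zero: "\<phi> (\<lambda>x. 0) = 0"
    and cnj: "\<And>f. \<phi> (\<lambda>x. cnj (f x)) = cnj (\<phi> f)"
    and pos: "\<And>r. fps_nth G r \<noteq> 0 \<Longrightarrow> Re (\<phi> (\<lambda>x. cnj (fps_nth G r x) * fps_nth G r x)) > 0"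
  shows "fps_complex_nonneg (coeffwise \<phi> (star (series_cnj G) G))"
proof -
  define P where "P = star (series_cnj G) G"
  define a where "a = Abs_fps (\<lambda>r. Re (\<phi> (fps_nth P r)))"
  have G': "series_cnj G \<in> formal_series (smooth_functions n X A)"
    using G by (auto simp: formal_series_def series_cnj_def smooth_functions_cnj)
  have cc: "series_cnj (series_cnj G) = G"
    by (intro fps_ext) (simp add: series_cnj_def)
  have "series_cnj P = P"
    unfolding P_def by (simp add: star_hermitian[OF G' G] cc)
  then have "(\<lambda>x. cnj (fps_nth P r x)) = fps_nth P r" for r
    by (auto simp: series_cnj_def fps_eq_iff)
  then have "cnj (\<phi> (fps_nth P r)) = \<phi> (fps_nth P r)" for r
    using cnj[of "fps_nth P r"] by simp
  then have "of_real (Re (\<phi> (fps_nth P r))) = \<phi> (fps_nth P r)" for r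
    using Reals_cnj_iff of_real_Re by blast
  then have eq: "coeffwise \<phi> P = Abs_fps (\<lambda>r. complex_of_real (fps_nth a r))"
    by (simp add: coeffwise_def a_def)
  have "a = 0 \<or> fps_positive a"
  proof (cases "G = 0")
    case True
    \<comment> \<open>The zero series has no lowest term, so \<open>k\<close> and \<open>l\<close> may be chosen beyond any given order.\<close>
    have "fps_nth P r = 0" for r
      using star_lowest_terms(1)[OF G' G, of "Suc r" "Suc r" r] True
      by (auto simp: P_def series_cnj_def fun_eq_iff)
    then have "a = 0"
      by (intro fps_ext) (simp add: a_def zero zero_fun_def)
    then show ?thesis ..
  next
    case False
    define k where "k = subdegree G"
    have low: "fps_nth G r = 0" "fps_nth (series_cnj G) r = 0" if "r < k" for r
      using that by (auto simp: k_def nth_less_subdegree_zero series_cnj_def)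
    note lt = star_lowest_terms[OF G' G low(2) low(1), folded P_def]
    have "fps_nth a (k + k) > 0"
      using pos[of k] False lt(2) by (simp add: a_def k_def series_cnj_def times_fun_def)
    moreover from this have "subdegree a = k + k"
      using lt(1) by (intro subdegreeI) (auto simp: a_def zero zero_fun_def)
    ultimately show ?thesis
      by (auto simp: fps_positive_def)
  qed
  then show ?thesis
    unfolding fps_complex_nonneg_def using eq P_def by blast
qed

theorem proposition5p3:
  fixes n :: nat
    and X :: "'a topology"
    and A :: "'a chart set"
    and br :: "('a \<Rightarrow> complex) \<Rightarrow> ('a \<Rightarrow> complex) \<Rightarrow> ('a \<Rightarrow> complex)"
    and star :: "('a \<Rightarrow> complex) fps \<Rightarrow> ('a \<Rightarrow> complex) fps \<Rightarrow> ('a \<Rightarrow> complex) fps"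
  assumes "poisson_manifold n X A br"
    and "hermitian_star_product n X A br star"
  shows "sufficiently_many_positive_functionals
           (formal_series (test_functions n X A)) star"
proof -
  interpret hermitian_star_product n X A br star by fact
  let ?T = "test_functions n X A"
  have sub: "?T \<subseteq> smooth_functions n X A"
    by (auto simp: test_functions_def)
  show ?thesis
    unfolding sufficiently_many_positive_functionals_def
  proof (intro ballI impI)
    fix F assume F: "F \<in> formal_series ?T" and "F \<noteq> 0 \<and> series_cnj F = F"
    then have "F \<noteq> 0" by simp
    define f where "f = fps_nth F (subdegree F)"
    have "f \<noteq> 0" using \<open>F \<noteq> 0\<close> by (simp add: f_def)
    then obtain p where p: "f p \<noteq> 0" by (auto simp: fun_eq_iff)
    have "f \<in> smooth_functions n X A" using F sub by (auto simp: f_def formal_series_def)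
    then have "topspace X \<noteq> {}" using p by (auto simp: smooth_functions_def)
    then obtain d :: "nat \<Rightarrow> 'a" where
      d: "\<And>g. g \<in> smooth_functions n X A \<Longrightarrow> g \<noteq> 0 \<Longrightarrow> \<exists>i. g (d i) \<noteq> 0"
      using exists_dense_sequence by blast
    \<comment> \<open>The two candidate values of \<open>\<phi> f\<close> differ by \<open>f p\<close>, so they are not both 0.\<close>
    have "atomic_functional 1 p d f = f p + atomic_functional 0 p d f"
      by (simp add: atomic_functional_def)
    then obtain c :: real where c: "c \<ge> 0" "atomic_functional c p d f \<noteq> 0"
      using p by (metis add.right_neutral order_refl zero_le_one)
    let ?\<omega> = "coeffwise (atomic_functional c p d)"
    have "fps_complex_nonneg (?\<omega> (star (series_cnj G) G))" if G: "G \<in> formal_series ?T" for G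
    proof (rule coeffwise_star_square_nonneg)
      show "G \<in> formal_series (smooth_functions n X A)"
        using G sub by (auto simp: formal_series_def)
      fix r assume "fps_nth G r \<noteq> 0"
      moreover have "fps_nth G r \<in> ?T" using G by (simp add: formal_series_def)
      ultimately show "Re (atomic_functional c p d (\<lambda>x. cnj (fps_nth G r x) * fps_nth G r x)) > 0"
        using d sub atomic_functional_square_pos[OF test_functions_bounded c(1)] by blast
    qed (simp_all add: atomic_functional_cnj)
    moreover have "series_linear_functional (formal_series ?T) ?\<omega>"
      by (rule coeffwise_atomic_linear[OF test_functions_bounded])
    moreover have "fps_nth (?\<omega> F) (subdegree F) \<noteq> 0"
      using c(2) by (simp add: coeffwise_def f_def)
    then have "?\<omega> F \<noteq> 0" by auto
    ultimately show "\<exists>\<omega>. positive_functional (formal_series ?T) star \<omega> \<and> \<omega> F \<noteq> 0"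
      unfolding positive_functional_def by blast
  qed
qed

end
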